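(* Let $P\subset\mathbb{R}^N$ be a polytope with vertex set $\{v_1,\dots,v_M\}$, and let $v:\mathbb{R}^N\to\{v_1,\dots,v_M\}$ be a map assigning to each $x$ a vertex of $P$ closest to $x$ in the Euclidean norm (with some fixed tie-breaking rule when several vertices are equally close). For each $\gamma\in P$ define $\phi_\gamma:\mathbb{R}^N\to\mathbb{R}^N$ by $$\phi_\gamma(x)=x+(\gamma-v(x)).$$ Then for every compact set $K\subset\mathbb{R}^N$ there exists a bounded convex set $Q\subset\mathbb{R}^N$ with $K\subset Q$ such that $\phi_\gamma(Q)\subset Q$ for all $\gamma\in P$.
   Context: A polytope is the convex hull of a finite set of points in $\mathbb{R}^N$; its vertices are its extreme points. The tie-breaking rule is arbitrary but fixed, so $v$ is a well-defined function with $\|x-v(x)\|=\min_i\|x-v_i\|$ for all $x$. *)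

theory Defs
  imports "HOL-Analysis.Analysis"
begin

end

theory Submission
  imports Defs
begin

text \<open>
  The invariant set is \<open>Q = {x. u \<bullet> x \<le> R - c\<^sub>k / R for all unit u}\<close>, where \<open>k\<close> is the number of
  vertices of \<open>P\<close> maximizing \<open>u\<close>, the constants \<open>c\<^sub>0 < c\<^sub>1 < \<dots>\<close> grow fast, and \<open>R\<close> is chosen last.
  If \<open>v x\<close> maximizes \<open>u\<close>, then \<open>u \<bullet> (\<gamma> - v x) \<le> 0\<close> and the constraint at \<open>u\<close> is preserved.
  Otherwise let \<open>\<delta>\<close> be the gap between the maximum of \<open>u\<close> on \<open>P\<close> and \<open>u \<bullet> v x\<close>. If the constraint at
  \<open>u\<close> failed after the step, then \<open>x\<close> would lie almost in direction \<open>u\<close> at distance almost \<open>R\<close>, and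
  since \<open>v x\<close> is the vertex closest to \<open>x\<close> this forces \<open>\<delta> = O(1/R)\<close> and a bounded component of \<open>x\<close>
  orthogonal to \<open>u\<close>. Normal cones are polyhedral, so some \<open>u\<^sub>0\<close> with \<open>u - u\<^sub>0 = O(\<delta>)\<close> is maximized by
  \<open>v x\<close> as well as by all maximizers of \<open>u\<close>. The constraint at \<open>u\<^sub>0\<close> involves \<open>c\<^sub>l\<close> with \<open>l > k\<close>, while
  \<open>u\<^sub>0 \<bullet> x / |u\<^sub>0|\<close> differs from \<open>u \<bullet> x\<close> only by \<open>O(1/R)\<close>; this is a contradiction when \<open>c\<^sub>l\<close> is large
  compared with \<open>c\<^sub>k\<close>.
\<close>

section \<open>Linear error bounds on polytopes\<close>

text \<open>A Hoffman-type bound. Write \<open>u\<close> as a convex combination of generators and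
  replace those with \<open>g \<bullet> s > 0\<close> by \<open>0\<close>; the finitely many ratios
  \<open>norm s / (g \<bullet> s)\<close> control the displacement.\<close>

lemma polytope_nonneg_functional_error_bound:
  fixes C :: "'a::euclidean_space set"
  assumes "polytope C" "0 \<in> C" and nonneg: "\<And>u. u \<in> C \<Longrightarrow> 0 \<le> g \<bullet> u"
  shows "\<exists>\<kappa>\<ge>0. \<forall>u\<in>C. \<exists>u0\<in>C. g \<bullet> u0 = 0 \<and> norm (u - u0) \<le> \<kappa> * (g \<bullet> u)"
proof -
  obtain S where S: "finite S" "C = convex hull S"
    using assms(1) unfolding polytope_def by blast
  have SC: "s \<in> C" if "s \<in> S" for s
    using that S(2) hull_inc by fast
  \<comment> \<open>The sum dominates every single ratio; generators with
    \<open>g \<bullet> s = 0\<close> contribute \<open>0\<close>, as division by zero yields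
    zero.\<close>
  define \<kappa> where "\<kappa> = (\<Sum>s\<in>S. norm s / (g \<bullet> s))"
  have terms: "0 \<le> norm s / (g \<bullet> s)" if "s \<in> S" for s
    using nonneg[OF SC[OF that]] by simp
  have \<kappa>0: "0 \<le> \<kappa>"
    unfolding \<kappa>_def by (rule sum_nonneg) (rule terms)
  have \<kappa>: "norm s \<le> \<kappa> * (g \<bullet> s)" if "s \<in> S" "g \<bullet> s \<noteq> 0" for s
  proof -
    have "norm s / (g \<bullet> s) \<le> \<kappa>"
      unfolding \<kappa>_def using S(1) terms that(1) by (intro member_le_sum) auto
    moreover have "0 < g \<bullet> s"
      using nonneg[OF SC[OF that(1)]] that(2) by simp
    ultimately show ?thesis by (simp add: field_simps)
  qed
  have "\<exists>u0\<in>C. g \<bullet> u0 = 0 \<and> norm (u - u0) \<le> \<kappa> * (g \<bullet> u)" if u: "u \<in> C" for u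
  proof -
    obtain a where a: "\<forall>s\<in>S. 0 \<le> a s" "sum a S = 1" "(\<Sum>s\<in>S. a s *\<^sub>R s) = u"
      using u unfolding S(2) convex_hull_finite[OF S(1)] by blast
    \<comment> \<open>Drop the generators on which the functional is positive.\<close>
    define u0 where "u0 = (\<Sum>s\<in>S. a s *\<^sub>R (if g \<bullet> s = 0 then s else 0))"
    have "u0 \<in> C"
      unfolding u0_def
    proof (rule convex_sum)
      show "convex C" using S(2) by simp
    qed (use S(1) a SC assms(2) in auto)
    moreover have "g \<bullet> u0 = 0"
      unfolding u0_def inner_sum_right by (rule sum.neutral) auto
    moreover have "norm (u - u0) \<le> \<kappa> * (g \<bullet> u)"
    proof -
      have "u - u0 = (\<Sum>s\<in>S. a s *\<^sub>R (if g \<bullet> s = 0 then 0 else s))"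
        unfolding u0_def a(3)[symmetric] sum_subtractf[symmetric]
        by (rule sum.cong) auto
      also have "norm \<dots> \<le> (\<Sum>s\<in>S. a s * (\<kappa> * (g \<bullet> s)))"
      proof (rule order_trans[OF norm_sum sum_mono])
        fix s assume s: "s \<in> S"
        show "norm (a s *\<^sub>R (if g \<bullet> s = 0 then 0 else s)) \<le> a s * (\<kappa> * (g \<bullet> s))"
          using a(1) s \<kappa>[OF s] by (cases "g \<bullet> s = 0") (auto intro: mult_left_mono)
      qed
      also have "\<dots> = \<kappa> * (g \<bullet> u)"
        unfolding a(3)[symmetric] inner_sum_right sum_distrib_left
        by (rule sum.cong) auto
      finally show ?thesis .
    qed
    ultimately show ?thesis by blast
  qed
  with \<kappa>0 show ?thesis by blast
qed

section \<open>Maximizing vertices and the enlargement of their set\<close>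

definition maximizers :: "'a::real_inner set \<Rightarrow> 'a \<Rightarrow> 'a set" where
  "maximizers V u = {w \<in> V. \<forall>z\<in>V. u \<bullet> z \<le> u \<bullet> w}"

lemma maximizers_scaleR:
  assumes "0 < c"
  shows "maximizers V (c *\<^sub>R u) = maximizers V u"
  using assms by (simp add: maximizers_def)

lemma maximizers_nonempty:
  assumes "finite V" "V \<noteq> {}"
  shows "maximizers V u \<noteq> {}"
proof -
  have "Max ((\<bullet>) u ` V) \<in> (\<bullet>) u ` V"
    using assms by (intro Max_in) auto
  then obtain w where w: "w \<in> V" "Max ((\<bullet>) u ` V) = u \<bullet> w" by auto
  have "u \<bullet> z \<le> u \<bullet> w" if "z \<in> V" for z
    unfolding w(2)[symmetric] using assms(1) that by (intro Max_ge) auto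
  with w(1) show ?thesis by (auto simp: maximizers_def)
qed

text \<open>The directions maximized by all of \<open>A\<close> form a polyhedral cone. Its part in
  a box is a polytope containing \<open>0\<close>, on which \<open>j - i\<close> is a nonnegative
  functional vanishing exactly where \<open>i\<close> is a maximizer too, so the error bound
  applies.\<close>

lemma maximizers_enlarge_fixed:
  fixes V :: "'a::euclidean_space set"
  assumes "finite V" "A \<subseteq> V" "j \<in> A" "i \<in> V"
  shows "\<exists>\<kappa>\<ge>0. \<forall>u. norm u = 1 \<longrightarrow> maximizers V u = A \<longrightarrow>
           (\<exists>u0. insert i A \<subseteq> maximizers V u0 \<and> norm (u - u0) \<le> \<kappa> * (u \<bullet> (j - i)))"
proof -
  define C where "C = cbox (- One) One \<inter> \<Inter>((\<lambda>(a,w). {u. (w - a) \<bullet> u \<le> 0}) ` (A \<times> V))"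
  have C_iff: "u \<in> C \<longleftrightarrow> u \<in> cbox (- One) One \<and> (\<forall>a\<in>A. \<forall>w\<in>V. u \<bullet> w \<le> u \<bullet> a)" for u
    by (auto simp: C_def inner_diff_left inner_commute[of u])
  have "finite A" using assms(1,2) by (rule finite_subset[rotated])
  have "polyhedron C"
    unfolding C_def
    by (intro polyhedron_Int polyhedron_Inter polyhedron_interval)
       (use assms(1) \<open>finite A\<close> polyhedron_halfspace_le in auto)
  then have "polytope C"
    unfolding polytope_eq_bounded_polyhedron C_def by (auto intro: bounded_subset[OF bounded_cbox])
  moreover have "0 \<in> C"
    by (simp add: C_iff mem_box)
  moreover have "0 \<le> (j - i) \<bullet> u" if "u \<in> C" for u
    using that assms(3,4) by (auto simp: C_iff inner_diff_right inner_commute[of _ u])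
  ultimately obtain \<kappa> where \<kappa>: "\<kappa> \<ge> 0"
    "\<And>u. u \<in> C \<Longrightarrow> \<exists>u0\<in>C. (j - i) \<bullet> u0 = 0 \<and> norm (u - u0) \<le> \<kappa> * ((j - i) \<bullet> u)"
    using polytope_nonneg_functional_error_bound[of C "j - i"] by blast
  have "\<exists>u0. insert i A \<subseteq> maximizers V u0 \<and> norm (u - u0) \<le> \<kappa> * (u \<bullet> (j - i))"
    if u: "norm u = 1" "maximizers V u = A" for u
  proof -
    have "\<bar>u \<bullet> b\<bar> \<le> 1" if "b \<in> Basis" for b
      using Basis_le_norm[OF that, of u] u(1) by simp
    then have "u \<in> cbox (- One) One"
      by (fastforce simp: mem_box abs_le_iff)
    then have "u \<in> C"
      using u(2) by (auto simp: C_iff maximizers_def)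
    then obtain u0 where u0: "u0 \<in> C" "(j - i) \<bullet> u0 = 0" "norm (u - u0) \<le> \<kappa> * ((j - i) \<bullet> u)"
      using \<kappa>(2) by blast
    have "u0 \<bullet> i = u0 \<bullet> j"
      using u0(2) by (simp add: inner_diff_right inner_commute[of _ u0])
    then have "insert i A \<subseteq> maximizers V u0"
      using u0(1) assms(2-4) by (auto simp: C_iff maximizers_def)
    with u0(3) show ?thesis by (auto simp: inner_commute)
  qed
  with \<kappa>(1) show ?thesis by blast
qed

text \<open>Only finitely many triples of a set of maximizers, \<open>j\<close> and \<open>i\<close>
  occur, so the sum of their constants serves all directions at once.\<close>

lemma maximizers_enlarge:
  fixes V :: "'a::euclidean_space set"
  assumes "finite V"
  shows "\<exists>\<kappa>\<ge>0. \<forall>u j i. norm u = 1 \<longrightarrow> j \<in> maximizers V u \<longrightarrow> i \<in> V \<longrightarrow>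
           (\<exists>u0. insert i (maximizers V u) \<subseteq> maximizers V u0 \<and>
                 norm (u - u0) \<le> \<kappa> * (u \<bullet> (j - i)))"
proof -
  define T where "T = Sigma (Pow V) (\<lambda>A. A \<times> V)"
  have "finite T"
    unfolding T_def using assms finite_subset[OF _ assms] by (intro finite_SigmaI finite_cartesian_product) auto
  define good where "good t \<kappa> \<longleftrightarrow> 0 \<le> \<kappa> \<and> (\<forall>u. norm u = 1 \<longrightarrow> maximizers V u = fst t \<longrightarrow>
      (\<exists>u0. insert (snd (snd t)) (fst t) \<subseteq> maximizers V u0 \<and>
            norm (u - u0) \<le> \<kappa> * (u \<bullet> (fst (snd t) - snd (snd t)))))" for t \<kappa>
  have "\<exists>\<kappa>. good t \<kappa>" if "t \<in> T" for t
  proof -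
    have "fst t \<subseteq> V" "fst (snd t) \<in> fst t" "snd (snd t) \<in> V"
      using that by (auto simp: T_def)
    from maximizers_enlarge_fixed[OF assms this] show ?thesis
      unfolding good_def .
  qed
  then obtain f where f: "\<And>t. t \<in> T \<Longrightarrow> good t (f t)" by metis
  have "\<exists>u0. insert i (maximizers V u) \<subseteq> maximizers V u0 \<and> norm (u - u0) \<le> sum f T * (u \<bullet> (j - i))"
    if u: "norm u = 1" "j \<in> maximizers V u" "i \<in> V" for u j i
  proof -
    have t: "(maximizers V u, j, i) \<in> T"
      using u by (auto simp: T_def maximizers_def)
    obtain u0 where u0: "insert i (maximizers V u) \<subseteq> maximizers V u0"
      "norm (u - u0) \<le> f (maximizers V u, j, i) * (u \<bullet> (j - i))"
      using f[OF t] u(1) unfolding good_def by auto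
    have "f (maximizers V u, j, i) \<le> sum f T"
      using \<open>finite T\<close> t f by (intro member_le_sum) (auto simp: good_def)
    moreover have "0 \<le> u \<bullet> (j - i)"
      using u by (auto simp: maximizers_def inner_diff_right)
    ultimately show ?thesis
      using u0 by (meson mult_right_mono order_trans)
  qed
  moreover have "0 \<le> sum f T" using f by (intro sum_nonneg) (simp add: good_def)
  ultimately show ?thesis by blast
qed

section \<open>Estimates near the boundary and the growing constants\<close>

text \<open>For nonnegative parameters this exceeds every \<open>t\<close> with
  \<open>t * (t - 4 * D) \<le> 2 * c + 4 * B\<close>: the summand \<open>1\<close> forces
  \<open>t \<ge> 1\<close> beyond it, so the product overshoots.\<close>

definition tangential_bound :: "real \<Rightarrow> real \<Rightarrow> real \<Rightarrow> real" where
  "tangential_bound B D c = 4 * D + 2 * c + 4 * B + 1"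

definition gap_bound :: "real \<Rightarrow> real \<Rightarrow> real \<Rightarrow> real" where
  "gap_bound B D c = 2 * B + 2 * D * tangential_bound B D c"

text \<open>Here \<open>d\<close> stands for \<open>j - v x\<close> with \<open>j\<close> a
  maximizer of \<open>u\<close>. Pythagoras bounds the squared tangential part by
  \<open>2 * c + 2 * (R * (u \<bullet> d))\<close>, and \<open>x \<bullet> d \<le> B\<close> bounds
  \<open>R * (u \<bullet> d)\<close> linearly in the tangential part; together they confine
  both.\<close>

lemma tangential_and_gap_bounds:
  fixes x u d :: "'a::real_inner"
  assumes u: "norm u = 1" and x: "norm x \<le> R"
    and d: "norm d \<le> D" "x \<bullet> d \<le> B" and \<delta>: "0 \<le> u \<bullet> d"
    and high: "R - c / R - u \<bullet> d < u \<bullet> x"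
    and R: "0 < R" "R / 2 \<le> R - c / R - D"
    and nonneg: "0 \<le> B" "0 \<le> c"
  shows "norm (x - (u \<bullet> x) *\<^sub>R u) \<le> tangential_bound B D c"
    and "R * (u \<bullet> d) \<le> gap_bound B D c"
proof -
  define a where "a = u \<bullet> x"
  define y where "y = x - a *\<^sub>R u"
  define \<delta> where "\<delta> = u \<bullet> d"
  have uu: "u \<bullet> u = 1" using u by (simp add: dot_square_norm)
  have D0: "0 \<le> D" using d(1) norm_ge_zero order_trans by blast
  have "\<delta> \<le> D"
    unfolding \<delta>_def using norm_cauchy_schwarz[of u d] u d(1) by simp
  then have a_half: "R / 2 \<le> a"
    using high R(2) unfolding a_def \<delta>_def by linarith
  have "a \<le> R"
    unfolding a_def using norm_cauchy_schwarz[of u x] u x by simp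
  have "(norm y)\<^sup>2 = (norm x)\<^sup>2 - a\<^sup>2"
    unfolding power2_norm_eq_inner y_def
    by (simp add: inner_diff inner_commute uu a_def power2_eq_square)
  also have "\<dots> \<le> R\<^sup>2 - a\<^sup>2"
    using x by (simp add: power_mono)
  also have "\<dots> = (R - a) * (R + a)" by (simp add: power2_eq_square algebra_simps)
  also have "\<dots> \<le> (c / R + \<delta>) * (2 * R)"
    using high \<open>a \<le> R\<close> a_half R(1) unfolding a_def \<delta>_def by (intro mult_mono) auto
  also have "\<dots> = 2 * c + 2 * (R * \<delta>)" using R(1) by (simp add: field_simps)
  finally have y2: "(norm y)\<^sup>2 \<le> 2 * c + 2 * (R * \<delta>)" .
  have "x \<bullet> d = a * \<delta> + y \<bullet> d"
    by (simp add: y_def \<delta>_def inner_diff_left)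
  moreover have "- (y \<bullet> d) \<le> norm y * D"
    using norm_cauchy_schwarz[of "- y" d] mult_left_mono[OF d(1), of "norm y"] by simp
  moreover have "R / 2 * \<delta> \<le> a * \<delta>"
    using a_half assms(5) unfolding \<delta>_def by (intro mult_right_mono)
  ultimately have s: "R * \<delta> \<le> 2 * B + 2 * (D * norm y)"
    using d(2) by (simp add: algebra_simps)
  have quad: "norm y * (norm y - 4 * D) \<le> 2 * c + 4 * B"
    using y2 s by (simp add: power2_eq_square algebra_simps)
  have Y: "norm y \<le> tangential_bound B D c"
  proof (rule ccontr)
    assume "\<not> ?thesis"
    then have "2 * c + 4 * B + 1 < norm y - 4 * D" "1 \<le> norm y"
      using nonneg D0 by (auto simp: tangential_bound_def)
    then have "1 * (2 * c + 4 * B + 1) \<le> norm y * (norm y - 4 * D)"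
      using nonneg by (intro mult_mono) auto
    with quad show False by simp
  qed
  then show "norm (x - (u \<bullet> x) *\<^sub>R u) \<le> tangential_bound B D c"
    by (simp add: y_def a_def)
  show "R * (u \<bullet> d) \<le> gap_bound B D c"
    using s mult_left_mono[OF Y D0] by (simp add: \<delta>_def gap_bound_def)
qed

text \<open>Turning from \<open>u\<close> to \<open>u0\<close> changes the pairing with the
  tangential part by at most \<open>\<epsilon> * Y\<close>, while \<open>norm u0\<close> exceeds the
  \<open>u\<close>-component of \<open>u0\<close> only to second order in \<epsilon>. Dividing by
  that component, which is at least \<open>1 / 2\<close>, at most doubles both errors.\<close>

lemma inner_excess_transfer:
  fixes x u u0 :: "'a::real_inner"
  assumes u: "norm u = 1" and near: "norm (u - u0) \<le> \<epsilon>" "\<epsilon> \<le> 1 / 2"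
    and Y: "norm (x - (u \<bullet> x) *\<^sub>R u) \<le> Y"
    and le: "u0 \<bullet> x \<le> norm u0 * \<rho>" and \<rho>: "\<rho> \<le> R" "0 \<le> \<rho>"
  shows "u \<bullet> x - \<rho> \<le> \<epsilon>\<^sup>2 * R + 2 * \<epsilon> * Y"
proof -
  define a where "a = u \<bullet> x"
  define y where "y = x - a *\<^sub>R u"
  define e where "e = u0 - u"
  define t where "t = 1 + e \<bullet> u"
  have uu: "u \<bullet> u = 1" using u by (simp add: dot_square_norm)
  have e: "norm e \<le> \<epsilon>" using near(1) by (simp add: e_def norm_minus_commute)
  have \<epsilon>0: "0 \<le> \<epsilon>" using e norm_ge_zero order_trans by blast
  have t: "1 / 2 \<le> t"
    using norm_cauchy_schwarz[of "- e" u] u e near(2) by (simp add: t_def)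
  have Y0: "0 \<le> Y" using Y norm_ge_zero order_trans by blast
  have e2: "(norm e)\<^sup>2 \<le> \<epsilon>\<^sup>2" using e by (simp add: power_mono)
  have "norm u0 \<le> t + \<epsilon>\<^sup>2 / 2"
  proof -
    have u0: "u0 = u + e" by (simp add: e_def)
    have "(norm u0)\<^sup>2 = 2 * t - 1 + (norm e)\<^sup>2"
      unfolding power2_norm_eq_inner u0 by (simp add: inner_add uu inner_commute t_def)
    \<comment> \<open>This bounds the square root by its tangent at \<open>1\<close>.\<close>
    moreover have "2 * norm u0 \<le> (norm u0)\<^sup>2 + 1"
      using sum_squares_bound[of "norm u0" 1] by simp
    ultimately show ?thesis using e2 by linarith
  qed
  then have "u0 \<bullet> x \<le> (t + \<epsilon>\<^sup>2 / 2) * \<rho>"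
    using le \<rho>(2) by (meson mult_right_mono order_trans)
  moreover have "u0 \<bullet> x = a * t + e \<bullet> y"
    by (simp add: y_def t_def e_def a_def algebra_simps uu)
  moreover have "- (e \<bullet> y) \<le> \<epsilon> * Y"
    using norm_cauchy_schwarz[of "- e" y] mult_mono[OF e Y \<epsilon>0] by (simp add: y_def a_def)
  moreover have "\<epsilon>\<^sup>2 / 2 * \<rho> \<le> \<epsilon>\<^sup>2 / 2 * R"
    using \<rho>(1) by (intro mult_left_mono) auto
  ultimately have *: "t * (a - \<rho>) \<le> \<epsilon>\<^sup>2 / 2 * R + \<epsilon> * Y"
    by (simp add: algebra_simps)
  show ?thesis
  proof (cases "0 \<le> a - \<rho>")
    case True
    have "1 / 2 * (a - \<rho>) \<le> t * (a - \<rho>)"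
      using t True by (rule mult_right_mono)
    with * show ?thesis by (simp add: a_def)
  next
    case False
    have "0 \<le> \<epsilon>\<^sup>2 * R + 2 * \<epsilon> * Y" using \<epsilon>0 Y0 \<rho> by simp
    with False show ?thesis by (simp add: a_def)
  qed
qed

text \<open>The constants \<open>c\<^sub>k\<close>: each increment is \<open>R\<close> times the total error made when passing from the
  constraint at \<open>u\<close> to the one at \<open>u\<^sub>0\<close>.\<close>
primrec depth :: "real \<Rightarrow> real \<Rightarrow> real \<Rightarrow> nat \<Rightarrow> real" where
  "depth \<kappa> B D 0 = 0"
| "depth \<kappa> B D (Suc k) = depth \<kappa> B D k + gap_bound B D (depth \<kappa> B D k)
     + (\<kappa> * gap_bound B D (depth \<kappa> B D k))\<^sup>2
     + 2 * (\<kappa> * gap_bound B D (depth \<kappa> B D k)) * tangential_bound B D (depth \<kappa> B D k)"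

lemma gap_bound_nonneg:
  assumes "0 \<le> B" "0 \<le> D" "0 \<le> c"
  shows "0 \<le> gap_bound B D c"
  using assms by (simp add: gap_bound_def tangential_bound_def)

lemma gap_bound_mono:
  assumes "0 \<le> D" "c \<le> c'"
  shows "gap_bound B D c \<le> gap_bound B D c'"
  using assms by (simp add: gap_bound_def tangential_bound_def mult_left_mono)

text \<open>Both claims are proved together, since an increment is seen to be nonnegative only once
  the preceding constant is.\<close>

lemma depth_nonneg_and_le_Suc:
  assumes "0 \<le> \<kappa>" "0 \<le> B" "0 \<le> D"
  shows "0 \<le> depth \<kappa> B D k \<and> depth \<kappa> B D k \<le> depth \<kappa> B D (Suc k)"
proof (induction k)
  case 0
  show ?case
    using assms gap_bound_nonneg[of B D 0] by (simp add: tangential_bound_def)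
next
  case (Suc k)
  then have "0 \<le> depth \<kappa> B D (Suc k)" by linarith
  then show ?case
    using assms gap_bound_nonneg[of B D "depth \<kappa> B D (Suc k)"]
    by (subst (3) depth.simps(2)) (simp add: tangential_bound_def del: depth.simps)
qed

lemma depth_mono:
  assumes "0 \<le> \<kappa>" "0 \<le> B" "0 \<le> D" "k \<le> l"
  shows "depth \<kappa> B D k \<le> depth \<kappa> B D l"
  by (rule lift_Suc_mono_le[OF _ assms(4)])
     (rule depth_nonneg_and_le_Suc[OF assms(1-3), THEN conjunct2])

section \<open>The invariant convex set\<close>

theorem theorem1p1:
  fixes P :: "'a::euclidean_space set" and v :: "'a \<Rightarrow> 'a"
  assumes "polytope P" and "P \<noteq> {}"
    and "\<And>x. v x extreme_point_of P"
    and "\<And>x w. w extreme_point_of P \<Longrightarrow> norm (x - v x) \<le> norm (x - w)"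
  shows "\<forall>K. compact K \<longrightarrow>
           (\<exists>Q. bounded Q \<and> convex Q \<and> K \<subseteq> Q \<and>
                (\<forall>\<gamma>\<in>P. (\<lambda>x. x + (\<gamma> - v x)) ` Q \<subseteq> Q))"
proof (intro allI impI)
  fix K :: "'a set" assume "compact K"
  define V where "V = {w. w extreme_point_of P}"
  have finV: "finite V"
    unfolding V_def using assms(1) by (intro finite_polyhedron_extreme_points polytope_imp_polyhedron)
  have vV: "v x \<in> V" for x using assms(3) by (simp add: V_def)
  have P_hull: "P = convex hull V"
    unfolding V_def
    using assms(1) by (intro Krein_Milman_Minkowski polytope_imp_compact polytope_imp_convex)
  obtain b where b: "0 < b" "\<And>w. w \<in> V \<Longrightarrow> norm w \<le> b"
    using finite_imp_bounded[OF finV] unfolding bounded_pos by blast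
  obtain r where r: "0 < r" "\<And>x. x \<in> K \<Longrightarrow> norm x \<le> r"
    using compact_imp_bounded[OF \<open>compact K\<close>] unfolding bounded_pos by blast
  obtain \<kappa> where \<kappa>: "0 \<le> \<kappa>"
    "\<And>u j i. norm u = 1 \<Longrightarrow> j \<in> maximizers V u \<Longrightarrow> i \<in> V \<Longrightarrow>
       \<exists>u0. insert i (maximizers V u) \<subseteq> maximizers V u0 \<and> norm (u - u0) \<le> \<kappa> * (u \<bullet> (j - i))"
    using maximizers_enlarge[OF finV] by metis
  \<comment> \<open>\<open>D\<close> bounds the distance between two vertices; \<open>B\<close>
    comes from expanding \<open>norm (x - v x) \<le> norm (x - j)\<close>, which leaves half a
    difference of squared vertex norms.\<close>
  define D where "D = 2 * b"
  define B where "B = b\<^sup>2 / 2"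
  have D0: "0 \<le> D" and B0: "0 \<le> B" using b(1) by (auto simp: D_def B_def)
  define c where "c = depth \<kappa> B D"
  define m where "m = c (card V)"
  \<comment> \<open>The first summand ensures \<open>\<rho> u \<ge> R / 2 + D\<close> and
    \<open>\<rho> u \<ge> r\<close>, the \<open>1\<close> ensures \<open>R \<ge> 1\<close>, and the
    last one ensures \<open>\<epsilon> \<le> 1 / 2\<close> below.\<close>
  define R where "R = 2 * (m + D + r) + 1 + 2 * \<kappa> * gap_bound B D m"
  define k where "k u = card (maximizers V u)" for u
  define \<rho> where "\<rho> u = R - c (k u) / R" for u
  define Q where "Q = {x. \<forall>u. norm u = 1 \<longrightarrow> u \<bullet> x \<le> \<rho> u}"
  have c0: "0 \<le> c n" for n
    using depth_nonneg_and_le_Suc[OF \<kappa>(1) B0 D0] by (simp add: c_def)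
  have c_mono: "c n \<le> c l" if "n \<le> l" for n l
    using depth_mono[OF \<kappa>(1) B0 D0 that] by (simp add: c_def)
  have k_le: "k u \<le> card V" for u
    unfolding k_def using finV by (intro card_mono) (auto simp: maximizers_def)
  have m0: "0 \<le> m" by (simp add: m_def c0)
  have gap0: "0 \<le> gap_bound B D (c n)" for n
    by (rule gap_bound_nonneg[OF B0 D0 c0])
  have R: "1 \<le> R" "2 * (m + D + r) \<le> R" "2 * \<kappa> * gap_bound B D m \<le> R"
    using m0 D0 r(1) \<kappa>(1) gap0[of "card V"] by (auto simp: R_def m_def)
  have c_div: "c (k u) / R \<le> m" for u
  proof -
    have "c (k u) / R \<le> c (k u) / 1"
      using R(1) c0 by (intro divide_left_mono) auto
    also have "\<dots> \<le> m" using c_mono[OF k_le] by (simp add: m_def)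
    finally show ?thesis .
  qed
  have \<rho>: "r \<le> \<rho> u" "0 \<le> \<rho> u" "\<rho> u \<le> R" "R / 2 \<le> \<rho> u - D" for u
    using c_div[of u] R m0 D0 r(1) c0[of "k u"] by (auto simp: \<rho>_def)
  have Q_norm: "norm x \<le> R" if "x \<in> Q" for x
  proof (cases "x = 0")
    case False
    then have "norm (x /\<^sub>R norm x) = 1" by simp
    then have "(x /\<^sub>R norm x) \<bullet> x \<le> \<rho> (x /\<^sub>R norm x)"
      using that unfolding Q_def by blast
    also have "(x /\<^sub>R norm x) \<bullet> x = norm x"
      using False by (simp add: dot_square_norm power2_eq_square)
    finally show ?thesis using \<rho>(3) order_trans by blast
  qed (use R(1) in simp)
  \<comment> \<open>Positive scaling keeps the maximizers, so the constraints extend homogeneously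
    to all nonzero directions; \<open>u0\<close> below need not be a unit vector.\<close>
  have Q_scaled: "u \<bullet> x \<le> norm u * \<rho> u" if "x \<in> Q" "u \<noteq> 0" for x u
  proof -
    have "norm (u /\<^sub>R norm u) = 1" using that(2) by simp
    then have "(u /\<^sub>R norm u) \<bullet> x \<le> \<rho> (u /\<^sub>R norm u)"
      using that(1) unfolding Q_def by blast
    also have "\<rho> (u /\<^sub>R norm u) = \<rho> u"
      using that(2) by (simp add: \<rho>_def k_def maximizers_scaleR)
    finally show ?thesis using that(2) by (simp add: field_simps)
  qed
  have "bounded Q"
    unfolding bounded_iff using Q_norm by blast
  moreover have "convex Q"
  proof -
    have "Q = (\<Inter>u\<in>{u. norm u = 1}. {x. u \<bullet> x \<le> \<rho> u})" by (auto simp: Q_def)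
    then show ?thesis by (auto intro!: convex_INT convex_halfspace_le)
  qed
  moreover have "K \<subseteq> Q"
  proof
    fix x assume "x \<in> K"
    have "u \<bullet> x \<le> \<rho> u" if "norm u = 1" for u
      using norm_cauchy_schwarz[of u x] that r(2)[OF \<open>x \<in> K\<close>] \<rho>(1)[of u] by simp
    then show "x \<in> Q" by (simp add: Q_def)
  qed
  moreover have "x + (\<gamma> - v x) \<in> Q" if "\<gamma> \<in> P" "x \<in> Q" for \<gamma> x
  proof -
    have "u \<bullet> (x + (\<gamma> - v x)) \<le> \<rho> u" if u: "norm u = 1" for u
    proof -
      obtain j where j: "j \<in> maximizers V u"
        using maximizers_nonempty[OF finV] vV by blast
      define d where "d = j - v x"
      have jV: "j \<in> V" using j by (simp add: maximizers_def)
      have "P \<subseteq> {z. u \<bullet> z \<le> u \<bullet> j}"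
        unfolding P_hull
        using j by (intro hull_minimal convex_halfspace_le) (auto simp: maximizers_def)
      then have up: "u \<bullet> (x + (\<gamma> - v x)) \<le> u \<bullet> x + u \<bullet> d"
        using \<open>\<gamma> \<in> P\<close> by (auto simp: d_def inner_add_right inner_diff_right)
      have \<delta>0: "0 \<le> u \<bullet> d"
        using j vV by (auto simp: d_def maximizers_def inner_diff_right)
      show ?thesis
      proof (cases "v x \<in> maximizers V u")
        case True
        then have "u \<bullet> d \<le> 0"
          using jV by (auto simp: d_def maximizers_def inner_diff_right)
        moreover have "u \<bullet> x \<le> \<rho> u" using \<open>x \<in> Q\<close> u by (simp add: Q_def)
        ultimately show ?thesis using up by linarith
      next
        case False
        show ?thesis
        proof (rule ccontr)
          assume "\<not> ?thesis"
          then have high: "R - c (k u) / R - u \<bullet> d < u \<bullet> x"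
            using up by (simp add: \<rho>_def)
          define S where "S = gap_bound B D (c (k u))"
          define Y where "Y = tangential_bound B D (c (k u))"
          have dD: "norm d \<le> D"
            using norm_triangle_ineq4[of j "v x"] b(2)[OF jV] b(2)[OF vV[of x]]
            by (simp add: d_def D_def)
          have dB: "x \<bullet> d \<le> B"
          proof -
            have "norm (x - v x) \<le> norm (x - j)"
              using assms(4) jV by (simp add: V_def)
            then have "(norm (x - v x))\<^sup>2 \<le> (norm (x - j))\<^sup>2"
              by (simp add: power_mono)
            then have "2 * (x \<bullet> d) \<le> (norm j)\<^sup>2 - (norm (v x))\<^sup>2"
              unfolding power2_norm_eq_inner d_def by (simp add: inner_diff inner_commute)
            also have "\<dots> \<le> b\<^sup>2"
              using power_mono[OF b(2)[OF jV] norm_ge_zero, of 2] zero_le_power2[of "norm (v x)"] by linarith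
            finally show ?thesis by (simp add: B_def)
          qed
          have R_half: "R / 2 \<le> R - c (k u) / R - D" using \<rho>(4)[of u] by (simp add: \<rho>_def)
          have "0 < R" using R(1) by simp
          note bounds = tangential_and_gap_bounds[OF u Q_norm[OF \<open>x \<in> Q\<close>] dD dB \<delta>0 high
              \<open>0 < R\<close> R_half B0 c0]
          obtain u0 where u0: "insert (v x) (maximizers V u) \<subseteq> maximizers V u0"
            "norm (u - u0) \<le> \<kappa> * (u \<bullet> d)"
            using \<kappa>(2)[OF u j vV] unfolding d_def by blast
          have \<delta>S: "u \<bullet> d \<le> S / R"
            using bounds(2) \<open>0 < R\<close> by (simp add: S_def field_simps)
          define \<epsilon> where "\<epsilon> = \<kappa> * S / R"
          have near: "norm (u - u0) \<le> \<epsilon>"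
            using u0(2) mult_left_mono[OF \<delta>S \<kappa>(1)] by (simp add: \<epsilon>_def)
          have "\<kappa> * S \<le> \<kappa> * gap_bound B D m"
            unfolding S_def m_def
            by (intro mult_left_mono gap_bound_mono D0 c_mono k_le \<kappa>(1))
          then have half: "\<epsilon> \<le> 1 / 2"
            using R(3) \<open>0 < R\<close> by (simp add: \<epsilon>_def field_simps)
          have "u0 \<noteq> 0" using near half u by auto
          then have le: "u0 \<bullet> x \<le> norm u0 * \<rho> u0" by (rule Q_scaled[OF \<open>x \<in> Q\<close>])
          have "u \<bullet> x - \<rho> u0 \<le> \<epsilon>\<^sup>2 * R + 2 * \<epsilon> * Y"
            using inner_excess_transfer[OF u near half bounds(1) le \<rho>(3) \<rho>(2)] by (simp add: Y_def)
          also have "\<dots> = ((\<kappa> * S)\<^sup>2 + 2 * (\<kappa> * S) * Y) / R"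
            using \<open>0 < R\<close> by (simp add: \<epsilon>_def power2_eq_square field_simps)
          finally have upper: "u \<bullet> x - \<rho> u0 \<le> ((\<kappa> * S)\<^sup>2 + 2 * (\<kappa> * S) * Y) / R" .
          \<comment> \<open>\<open>v x\<close> is a new maximizer, so the count grows by at least
            one.\<close>
          have "maximizers V u \<subset> maximizers V u0" using u0(1) False by blast
          moreover have "finite (maximizers V u0)"
            using finV by (simp add: maximizers_def)
          ultimately have "Suc (k u) \<le> k u0"
            unfolding k_def by (simp add: psubset_card_mono Suc_leI)
          then have "c (Suc (k u)) / R \<le> c (k u0) / R"
            using \<open>0 < R\<close> by (intro divide_right_mono c_mono) auto
          moreover have "c (Suc (k u)) / R
              = c (k u) / R + S / R + ((\<kappa> * S)\<^sup>2 + 2 * (\<kappa> * S) * Y) / R"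
            by (simp add: c_def S_def Y_def add_divide_distrib)
          \<comment> \<open>The increment from \<open>c (k u)\<close> to
            \<open>c (Suc (k u))\<close> covers both losses, the gap \<open>S / R\<close> and the
            transfer error, so \<open>upper\<close> contradicts \<open>high\<close>.\<close>
          ultimately show False
            using upper high \<delta>S by (simp add: \<rho>_def)
        qed
      qed
    qed
    then show ?thesis by (simp add: Q_def)
  qed
  ultimately show "\<exists>Q. bounded Q \<and> convex Q \<and> K \<subseteq> Q \<and>
      (\<forall>\<gamma>\<in>P. (\<lambda>x. x + (\<gamma> - v x)) ` Q \<subseteq> Q)"
    by (intro exI[of _ Q]) auto
qed

end
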